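(* Let $\boldsymbol u_1,\boldsymbol u_2\in\mathbb R^d$ with $|\boldsymbol u_1|,|\boldsymbol u_2|<c$, and let $\boldsymbol w$ and $\rho(\boldsymbol u_1,\boldsymbol u_2)$ be the velocity and the frequency dilation of the two-step transport $w(\boldsymbol u_2)w(\boldsymbol u_1)$, as defined in the context. (i) If $\boldsymbol u_1\cdot\boldsymbol u_2=0$, then $\boldsymbol w$ coincides exactly with the relativistic (Einstein) velocity composition $\boldsymbol u_2\oplus\boldsymbol u_1$ at signal speed $c$, and $\rho(\boldsymbol u_1,\boldsymbol u_2)=1$. (ii) Exchanging the order of the steps changes $\rho$: whenever $\rho(\boldsymbol u_1,\boldsymbol u_2)$ and $\rho(\boldsymbol u_2,\boldsymbol u_1)$ are both defined, $$\frac{\rho(\boldsymbol u_1,\boldsymbol u_2)}{\rho(\boldsymbol u_2,\boldsymbol u_1)}=\left[\frac{\mathcal D(|\boldsymbol u_2|)\,(c^2-|\boldsymbol u_1|^2)}{\mathcal D(|\boldsymbol u_1|)\,(c^2-|\boldsymbol u_2|^2)}\right]^{1/2},\qquad \mathcal D(u):=(c^2-\boldsymbol u_1\cdot\boldsymbol u_2)^2-c^2u^2,$$ and this ratio differs from unity at fourth order in $M:=\max(|\boldsymbol u_1|,|\boldsymbol u_2|)/c$: it is $1+O(M^4)$ as $M\to0$, with a fourth-order term that is not identically zero.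
   Context: Fix $c>0$ and $d\in\{2,3\}$; coordinates on $\mathbb R^{1+d}$ are $(t,\boldsymbol x)$, index $0$ refers to $t$. For $|\boldsymbol v|<c$ let $\gamma(\boldsymbol v)=(1-|\boldsymbol v|^2/c^2)^{-1/2}$, $\hat{\boldsymbol v}=\boldsymbol v/|\boldsymbol v|$ (terms containing $\hat{\boldsymbol v}$ are read as $0$ if $\boldsymbol v=0$); define linear maps (identified with matrices) $g(\boldsymbol v):(t,\boldsymbol x)\mapsto(t,\boldsymbol x-\boldsymbol vt)$, $\ell(\boldsymbol v):(t,\boldsymbol x)\mapsto\bigl(\gamma(t-\boldsymbol v\cdot\boldsymbol x/c^2),\ \boldsymbol x+(\gamma-1)(\hat{\boldsymbol v}\cdot\boldsymbol x)\hat{\boldsymbol v}-\gamma\boldsymbol vt\bigr)$, with $\gamma=\gamma(\boldsymbol v)$, and $w(\boldsymbol v)=\ell(-\boldsymbol v)g(\boldsymbol v)$. Let $Q_*=\begin{pmatrix}1&0\\0&-c^2I\end{pmatrix}$. For the two-step transport $W=w(\boldsymbol u_2)w(\boldsymbol u_1)$ put $q_{00}=(W^{-1}Q_*W^{-\mathrm T})_{00}$ and, when $q_{00}>0$, $\rho(\boldsymbol u_1,\boldsymbol u_2)=q_{00}^{-1/2}$. With $\gamma_i=\gamma(\boldsymbol u_i)$, the velocity $\boldsymbol w$ is defined by $e_0^{\mathrm T}W^{-1}=\gamma_1\gamma_2\,(1,-\boldsymbol w^{\mathrm T}/c^2)$, explicitly $\boldsymbol w=(1-\boldsymbol u_1\cdot\boldsymbol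 u_2/c^2)\boldsymbol u_2+\boldsymbol u_1/\gamma_2+(1-1/\gamma_2)(\hat{\boldsymbol u}_2\cdot\boldsymbol u_1)\hat{\boldsymbol u}_2$. Einstein composition: $\boldsymbol u\oplus\boldsymbol v=\dfrac{1}{1+\boldsymbol u\cdot\boldsymbol v/c^2}\Bigl[\boldsymbol u+\dfrac{\boldsymbol v}{\gamma(\boldsymbol u)}+\Bigl(1-\dfrac1{\gamma(\boldsymbol u)}\Bigr)(\hat{\boldsymbol u}\cdot\boldsymbol v)\hat{\boldsymbol u}\Bigr]$. *)

theory Defs
  imports "HOL-Analysis.Analysis" "HOL-Library.Landau_Symbols"
begin

text \<open>
  A vector of $R^{1+d}$ has type \<^typ>\<open>real ^ ('n::finite) option\<close> with $d$ = \<^term>\<open>CARD('n)\<close>: the index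
  \<^term>\<open>None\<close> is the time index 0 and \<^term>\<open>Some j\<close> are the spatial indices.
\<close>

definition event :: "real \<Rightarrow> real ^ 'n \<Rightarrow> real ^ ('n::finite) option"
  where "event t x = (\<chi> i. case i of None \<Rightarrow> t | Some j \<Rightarrow> x $ j)"

definition time_part :: "real ^ ('n::finite) option \<Rightarrow> real"
  where "time_part X = X $ None"

definition space_part :: "real ^ ('n::finite) option \<Rightarrow> real ^ 'n"
  where "space_part X = (\<chi> j. X $ Some j)"

definition lorentz_factor :: "real \<Rightarrow> real ^ 'n \<Rightarrow> real"
  where "lorentz_factor c v = 1 / sqrt (1 - (norm v)\<^sup>2 / c\<^sup>2)"

text \<open>
  The unit vector $v/|v|$ is \<^term>\<open>sgn v\<close>; since \<^prop>\<open>sgn (0 :: real ^ 'n) = 0\<close>, the terms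
  containing it vanish for $v = 0$.
\<close>

definition galilei :: "real ^ 'n \<Rightarrow> real ^ ('n::finite) option \<Rightarrow> real ^ ('n::finite) option"
  where "galilei v X = event (time_part X) (space_part X - time_part X *\<^sub>R v)"

definition lorentz :: "real \<Rightarrow> real ^ 'n \<Rightarrow> real ^ ('n::finite) option \<Rightarrow> real ^ ('n::finite) option"
  where "lorentz c v X =
    (let \<gamma> = lorentz_factor c v; t = time_part X; x = space_part X
     in event (\<gamma> * (t - (v \<bullet> x) / c\<^sup>2))
              (x + ((\<gamma> - 1) * (sgn v \<bullet> x)) *\<^sub>R sgn v - (\<gamma> * t) *\<^sub>R v))"

definition transport :: "real \<Rightarrow> real ^ 'n \<Rightarrow> real ^ ('n::finite) option ^ 'n option"
  where "transport c v = matrix (lorentz c (- v)) ** matrix (galilei v)"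

definition two_step :: "real \<Rightarrow> real ^ 'n \<Rightarrow> real ^ 'n \<Rightarrow> real ^ ('n::finite) option ^ 'n option"
  where "two_step c u\<^sub>1 u\<^sub>2 = transport c u\<^sub>2 ** transport c u\<^sub>1"

definition Q_star :: "real \<Rightarrow> real ^ ('n::finite) option ^ 'n option"
  where "Q_star c = (\<chi> i j. if i = j then (if i = None then 1 else - c\<^sup>2) else 0)"

definition q00 :: "real \<Rightarrow> real ^ 'n \<Rightarrow> real ^ 'n \<Rightarrow> real"
  where "q00 c u\<^sub>1 u\<^sub>2 =
    (let V = matrix_inv (two_step c u\<^sub>1 u\<^sub>2) in (V ** Q_star c ** transpose V) $ None $ None)"

text \<open>The value of \<open>dilation\<close> is meaningful only under \<open>dilation_defined\<close>.\<close>

definition dilation_defined :: "real \<Rightarrow> real ^ 'n \<Rightarrow> real ^ 'n \<Rightarrow> bool"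
  where "dilation_defined c u\<^sub>1 u\<^sub>2 \<longleftrightarrow> q00 c u\<^sub>1 u\<^sub>2 > 0"

definition dilation :: "real \<Rightarrow> real ^ 'n \<Rightarrow> real ^ 'n \<Rightarrow> real"
  where "dilation c u\<^sub>1 u\<^sub>2 = 1 / sqrt (q00 c u\<^sub>1 u\<^sub>2)"

text \<open>
  The velocity of the two-step transport is read off from the time row of the inverse matrix.
\<close>

definition two_step_velocity :: "real \<Rightarrow> real ^ 'n \<Rightarrow> real ^ 'n \<Rightarrow> real ^ 'n"
  where "two_step_velocity c u\<^sub>1 u\<^sub>2 =
    (THE w. row None (matrix_inv (two_step c u\<^sub>1 u\<^sub>2)) =
      (lorentz_factor c u\<^sub>1 * lorentz_factor c u\<^sub>2) *\<^sub>R event 1 (- (w /\<^sub>R c\<^sup>2)))"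

definition einstein_add :: "real \<Rightarrow> real ^ 'n \<Rightarrow> real ^ 'n \<Rightarrow> real ^ 'n"
  where "einstein_add c u v =
    (1 / (1 + (u \<bullet> v) / c\<^sup>2)) *\<^sub>R
      (u + v /\<^sub>R lorentz_factor c u + ((1 - 1 / lorentz_factor c u) * (sgn u \<bullet> v)) *\<^sub>R sgn u)"

definition D_fun :: "real \<Rightarrow> real ^ 'n \<Rightarrow> real ^ 'n \<Rightarrow> real \<Rightarrow> real"
  where "D_fun c u\<^sub>1 u\<^sub>2 u = (c\<^sup>2 - u\<^sub>1 \<bullet> u\<^sub>2)\<^sup>2 - c\<^sup>2 * u\<^sup>2"

definition exchange_ratio :: "real \<Rightarrow> (real ^ 'n) \<times> (real ^ 'n) \<Rightarrow> real"
  where "exchange_ratio c = (\<lambda>(u\<^sub>1, u\<^sub>2). dilation c u\<^sub>1 u\<^sub>2 / dilation c u\<^sub>2 u\<^sub>1)"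

definition max_speed_ratio :: "real \<Rightarrow> (real ^ 'n) \<times> (real ^ 'n) \<Rightarrow> real"
  where "max_speed_ratio c = (\<lambda>(u\<^sub>1, u\<^sub>2). max (norm u\<^sub>1) (norm u\<^sub>2) / c)"

text \<open>Pairs of velocities with \<^term>\<open>max_speed_ratio c\<close> tending to 0, uniformly in the directions.\<close>

definition slow :: "real \<Rightarrow> ((real ^ 'n) \<times> (real ^ 'n)) filter"
  where "slow c = filtercomap (max_speed_ratio c) (at_right 0)"

definition homogeneous_polynomial :: "nat \<Rightarrow> ('a::real_normed_vector \<Rightarrow> real) \<Rightarrow> bool"
  where "homogeneous_polynomial k P \<longleftrightarrow>
    real_polynomial_function P \<and> (\<forall>s z. P (s *\<^sub>R z) = s ^ k * P z)"

end

theory Submission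
  imports Defs
begin

text \<open>
  The inverse of the two-step transport is \<open>g(-u\<^sub>1) \<ell>(u\<^sub>1) g(-u\<^sub>2) \<ell>(u\<^sub>2)\<close>, so its time row can be
  read off explicitly. With \<open>a = u\<^sub>1 \<bullet> u\<^sub>2 / c\<^sup>2\<close> and \<open>b\<^sub>i = |u\<^sub>i|\<^sup>2 / c\<^sup>2\<close> the identity
  \<open>1 - |w|\<^sup>2 / c\<^sup>2 = (1 - b\<^sub>2) ((1 - a)\<^sup>2 - b\<^sub>1)\<close> gives \<open>q\<^sub>0\<^sub>0 = ((1 - a)\<^sup>2 - b\<^sub>1) / (1 - b\<^sub>1)\<close>.
  Hence the exchange ratio is \<open>sqrt (1 + X)\<close> with \<open>X\<close> equal to \<open>(b\<^sub>1 - b\<^sub>2) (2 a - a\<^sup>2)\<close> over a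
  denominator tending to 1, and its fourth-order term is \<open>(b\<^sub>1 - b\<^sub>2) a\<close>.
\<close>

section \<open>Time and space parts of events\<close>

lemma time_part_event [simp]: "time_part (event t x) = t"
  by (simp add: time_part_def event_def)

lemma space_part_event [simp]: "space_part (event t x) = x"
  by (simp add: space_part_def event_def vec_eq_iff)

lemma event_eq_iff: "event t x = event s y \<longleftrightarrow> t = s \<and> x = y"
  by (metis space_part_event time_part_event)

lemma event_parts [simp]: "event (time_part X) (space_part X) = X"
  by (simp add: vec_eq_iff event_def time_part_def space_part_def split: option.split)

lemma sum_UNIV_option:
  fixes f :: "'n::finite option \<Rightarrow> 'a::comm_monoid_add"
  shows "sum f UNIV = f None + (\<Sum>j\<in>UNIV. f (Some j))"
  by (simp add: UNIV_option_conv sum.reindex)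

lemma inner_event: "event t x \<bullet> X = t * time_part X + x \<bullet> space_part X"
  by (simp add: inner_vec_def sum_UNIV_option event_def time_part_def space_part_def)

lemma scaleR_event: "a *\<^sub>R event t x = event (a * t) (a *\<^sub>R x)"
  by (simp add: vec_eq_iff event_def split: option.split)

lemma linear_time_part: "linear time_part"
  by (rule linearI) (simp_all add: time_part_def)

lemma linear_space_part: "linear space_part"
  by (rule linearI) (simp_all add: space_part_def vec_eq_iff)

lemma event_add: "event t x + event s y = event (t + s) (x + y)"
  by (simp add: vec_eq_iff event_def split: option.split)

section \<open>Linearity and inverses of the Galilei and Lorentz maps\<close>

lemma linear_galilei: "linear (galilei v)"
  by (rule linearI)
     (simp_all add: galilei_def event_add scaleR_event event_eq_iff linear_add[OF linear_time_part]
       linear_add[OF linear_space_part] linear_cmul[OF linear_time_part]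
       linear_cmul[OF linear_space_part] algebra_simps)

lemma linear_lorentz: "linear (lorentz c v)"
  by (rule linearI)
     (simp_all add: lorentz_def Let_def event_add scaleR_event event_eq_iff
       linear_add[OF linear_time_part] linear_add[OF linear_space_part]
       linear_cmul[OF linear_time_part] linear_cmul[OF linear_space_part]
       inner_add_right algebra_simps add_divide_distrib)

lemma galilei_minus_galilei: "galilei (- v) (galilei v X) = X"
  by (simp add: galilei_def)

lemma norm_ratio_less_one:
  assumes "norm v < c"
  shows "(norm v)\<^sup>2 / c\<^sup>2 < 1"
proof -
  have "c > 0"
    using assms norm_ge_zero[of v] by linarith
  with assms show ?thesis
    by (simp add: divide_simps power_strict_mono)
qed

lemma lorentz_factor_pos:
  assumes "norm v < c"
  shows "lorentz_factor c v > 0"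
  using norm_ratio_less_one[OF assms] by (simp add: lorentz_factor_def)

lemma lorentz_factor_square:
  assumes "norm v < c"
  shows "(lorentz_factor c v)\<^sup>2 * (1 - (norm v)\<^sup>2 / c\<^sup>2) = 1"
proof -
  define k where "k = 1 - (norm v)\<^sup>2 / c\<^sup>2"
  have "k > 0"
    using norm_ratio_less_one[OF assms] by (simp add: k_def)
  then show ?thesis
    unfolding lorentz_factor_def k_def[symmetric] by (simp add: power_divide)
qed

lemma lorentz_factor_minus [simp]: "lorentz_factor c (- v) = lorentz_factor c v"
  by (simp add: lorentz_factor_def)

text \<open>Only the time and the component along the unit vector \<open>n\<close> are mixed, so the
  claim reduces to two polynomial identities that follow from
  \<open>\<gamma>\<^sup>2 * (1 - r * b) = 1\<close>.\<close>

lemma lorentz_minus_lorentz: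
  assumes "norm v < c"
  shows "lorentz c (- v) (lorentz c v X) = X"
proof (cases "v = 0")
  case True
  then show ?thesis
    by (simp add: lorentz_def lorentz_factor_def Let_def)
next
  case False
  \<comment> \<open>For \<open>v \<noteq> 0\<close>, \<open>n\<close> is a genuine unit vector.
    Absorbing the division by \<open>c\<^sup>2\<close> into \<open>b\<close> leaves identities
    without division, as \<open>algebra\<close> requires.\<close>
  define n r \<gamma> b t x where "n = sgn v" and "r = norm v" and "\<gamma> = lorentz_factor c v"
    and "b = r / c\<^sup>2" and "t = time_part X" and "x = space_part X"
  have nn: "n \<bullet> n = 1"
    using False by (simp add: n_def norm_eq_1[symmetric] norm_sgn)
  have v: "v = r *\<^sub>R n"
    by (cases "v = 0") (simp_all add: n_def r_def sgn_div_norm)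
  have sgn_minus: "sgn (- v) = - n"
    by (simp add: n_def sgn_minus)
  have g: "\<gamma>\<^sup>2 * (1 - r * b) = 1"
    using lorentz_factor_square[OF assms] by (simp add: \<gamma>_def r_def b_def power2_eq_square)
  have L: "lorentz c v X = event (\<gamma> * (t - b * (n \<bullet> x))) (x + ((\<gamma> - 1) * (n \<bullet> x) - \<gamma> * r * t) *\<^sub>R n)"
    unfolding lorentz_def Let_def \<gamma>_def[symmetric] t_def[symmetric] x_def[symmetric] n_def[symmetric]
    by (simp add: v b_def algebra_simps)
  have L': "lorentz c (- v) (event s y)
      = event (\<gamma> * (s + b * (n \<bullet> y))) (y + ((\<gamma> - 1) * (n \<bullet> y) + \<gamma> * r * s) *\<^sub>R n)" for s y
    unfolding lorentz_def Let_def lorentz_factor_minus \<gamma>_def[symmetric] sgn_minus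
    by (simp add: v b_def algebra_simps)
  have ny: "n \<bullet> (x + ((\<gamma> - 1) * (n \<bullet> x) - \<gamma> * r * t) *\<^sub>R n) = \<gamma> * (n \<bullet> x) - \<gamma> * r * t"
    by (simp add: inner_add_right nn algebra_simps)
  have time: "\<gamma> * (\<gamma> * (t - b * (n \<bullet> x)) + b * (\<gamma> * (n \<bullet> x) - \<gamma> * r * t)) = t"
    using g by algebra
  \<comment> \<open>This is the total multiple of \<open>n\<close> added to \<open>x\<close> by the
    two boosts; the terms in \<open>t\<close> cancel outright, those in \<open>n \<bullet> x\<close>
    by \<open>g\<close>.\<close>
  have coeff: "((\<gamma> - 1) * (n \<bullet> x) - \<gamma> * r * t) + ((\<gamma> - 1) * (\<gamma> * (n \<bullet> x) - \<gamma> * r * t)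
      + \<gamma> * r * (\<gamma> * (t - b * (n \<bullet> x)))) = 0"
    using g by algebra
  have "lorentz c (- v) (lorentz c v X) = event t (x + (((\<gamma> - 1) * (n \<bullet> x) - \<gamma> * r * t)
      + ((\<gamma> - 1) * (\<gamma> * (n \<bullet> x) - \<gamma> * r * t) + \<gamma> * r * (\<gamma> * (t - b * (n \<bullet> x))))) *\<^sub>R n)"
    unfolding L L' ny time by (simp only: scaleR_left_distrib add.assoc)
  then show ?thesis
    unfolding coeff by (simp add: t_def x_def)
qed

section \<open>The inverse matrix of the two-step transport\<close>

lemma matrix_mult_matrix_eq_mat_1:
  fixes f g :: "real ^ 'm::finite \<Rightarrow> real ^ 'm"
  assumes "linear f" "linear g" "\<And>x. f (g x) = x"
  shows "matrix f ** matrix g = mat 1"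
proof -
  have "f \<circ> g = id"
    using assms(3) by auto
  show ?thesis
    using matrix_compose[OF assms(2,1)] unfolding \<open>f \<circ> g = id\<close> matrix_id_mat_1 by (rule sym)
qed

text \<open>A left inverse of a square matrix is two-sided, so the choice in
  \<open>matrix_inv\<close> has a witness, and associativity forces the chosen inverse to be
  \<open>B\<close>.\<close>

lemma matrix_inv_eqI:
  fixes A B :: "real ^ 'm::finite ^ 'm"
  assumes "B ** A = mat 1"
  shows "matrix_inv A = B"
proof -
  have AB: "A ** B = mat 1"
    using assms by (simp add: matrix_left_right_inverse)
  with assms have "\<exists>A'. A ** A' = mat 1 \<and> A' ** A = mat 1"
    by blast
  then have "matrix_inv A ** A = mat 1"
    unfolding matrix_inv_def by (rule someI2_ex) blast
  have "matrix_inv A = matrix_inv A ** (A ** B)"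
    unfolding AB by simp
  also have "\<dots> = B"
    unfolding matrix_mul_assoc \<open>matrix_inv A ** A = mat 1\<close> by simp
  finally show ?thesis .
qed

text \<open>Each \<open>transport c v\<close> is cancelled from the left by the Lorentz map of
  \<open>v\<close> followed by the Galilei map of \<open>- v\<close>; with the factors in reverse
  order the product telescopes from the middle.\<close>

lemma matrix_inv_two_step:
  fixes u\<^sub>1 u\<^sub>2 :: "real ^ 'n::finite"
  assumes "norm u\<^sub>1 < c" "norm u\<^sub>2 < c"
  shows "matrix_inv (two_step c u\<^sub>1 u\<^sub>2) =
    (matrix (galilei (- u\<^sub>1)) ** matrix (lorentz c u\<^sub>1)) **
    (matrix (galilei (- u\<^sub>2)) ** matrix (lorentz c u\<^sub>2))"
proof (rule matrix_inv_eqI)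
  have g: "matrix (galilei (- v)) ** matrix (galilei v) = mat 1" for v :: "real ^ 'n"
    by (intro matrix_mult_matrix_eq_mat_1 linear_galilei galilei_minus_galilei)
  have l: "matrix (lorentz c v) ** matrix (lorentz c (- v)) = mat 1" if "norm v < c" for v :: "real ^ 'n"
    using lorentz_minus_lorentz[of "- v" c] that
    by (intro matrix_mult_matrix_eq_mat_1 linear_lorentz) auto
  have w: "(matrix (galilei (- v)) ** matrix (lorentz c v)) ** transport c v = mat 1"
    if "norm v < c" for v :: "real ^ 'n"
  proof -
    have "(matrix (galilei (- v)) ** matrix (lorentz c v)) ** transport c v =
      matrix (galilei (- v)) ** (matrix (lorentz c v) ** matrix (lorentz c (- v))) ** matrix (galilei v)"
      by (simp add: transport_def matrix_mul_assoc)
    then show ?thesis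
      by (simp add: l[OF that] g)
  qed
  let ?A = "matrix (galilei (- u\<^sub>1)) ** matrix (lorentz c u\<^sub>1)"
  let ?B = "matrix (galilei (- u\<^sub>2)) ** matrix (lorentz c u\<^sub>2)"
  have "(?A ** ?B) ** two_step c u\<^sub>1 u\<^sub>2 = ?A ** (?B ** transport c u\<^sub>2) ** transport c u\<^sub>1"
    by (simp add: two_step_def matrix_mul_assoc)
  then show "(?A ** ?B) ** two_step c u\<^sub>1 u\<^sub>2 = mat 1"
    by (simp add: w assms)
qed

section \<open>The velocity of the two-step transport\<close>

definition step_velocity :: "real \<Rightarrow> real ^ 'n \<Rightarrow> real ^ 'n \<Rightarrow> real ^ ('n::finite)"
  where "step_velocity c u\<^sub>1 u\<^sub>2 = (1 - (u\<^sub>1 \<bullet> u\<^sub>2) / c\<^sup>2) *\<^sub>R u\<^sub>2 + u\<^sub>1 /\<^sub>R lorentz_factor c u\<^sub>2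
    + ((1 - 1 / lorentz_factor c u\<^sub>2) * (sgn u\<^sub>2 \<bullet> u\<^sub>1)) *\<^sub>R sgn u\<^sub>2"

text \<open>A vector is determined by its inner products. The inner product of the time row with
  \<open>X\<close> is the time part of the image of \<open>X\<close>, which is followed through the
  four maps.\<close>

lemma row_None_inv_two_step:
  fixes u\<^sub>1 u\<^sub>2 :: "real ^ 'n::finite"
  assumes "norm u\<^sub>1 < c" "norm u\<^sub>2 < c"
  shows "row None (matrix_inv (two_step c u\<^sub>1 u\<^sub>2)) =
    (lorentz_factor c u\<^sub>1 * lorentz_factor c u\<^sub>2) *\<^sub>R event 1 (- (step_velocity c u\<^sub>1 u\<^sub>2 /\<^sub>R c\<^sup>2))"
    (is "row None ?V = ?R")
proof -
  have "row None ?V \<bullet> X = ?R \<bullet> X" for X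
  proof -
    define \<gamma>\<^sub>1 \<gamma>\<^sub>2 t x where "\<gamma>\<^sub>1 = lorentz_factor c u\<^sub>1" and "\<gamma>\<^sub>2 = lorentz_factor c u\<^sub>2"
      and "t = time_part X" and "x = space_part X"
    have g0: "\<gamma>\<^sub>2 \<noteq> 0"
      using lorentz_factor_pos[OF assms(2)] by (simp add: \<gamma>\<^sub>2_def)
    have "row None ?V \<bullet> X = time_part (?V *v X)"
      by (simp add: time_part_def row_def matrix_vector_mult_def inner_vec_def)
    also have "\<dots> = time_part (galilei (- u\<^sub>1) (lorentz c u\<^sub>1 (galilei (- u\<^sub>2) (lorentz c u\<^sub>2 X))))"
      by (simp add: matrix_inv_two_step[OF assms] matrix_vector_mul_assoc[symmetric]
          matrix_works linear_galilei linear_lorentz)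
    \<comment> \<open>The outermost Galilei map preserves time and leaves no trace; the inner one
      contributes the last multiple of \<open>u\<^sub>2\<close>.\<close>
    also have "\<dots> = \<gamma>\<^sub>1 * (\<gamma>\<^sub>2 * (t - (u\<^sub>2 \<bullet> x) / c\<^sup>2) - (u\<^sub>1 \<bullet> (x + ((\<gamma>\<^sub>2 - 1) * (sgn u\<^sub>2 \<bullet> x)) *\<^sub>R sgn u\<^sub>2
        - (\<gamma>\<^sub>2 * t) *\<^sub>R u\<^sub>2 + (\<gamma>\<^sub>2 * (t - (u\<^sub>2 \<bullet> x) / c\<^sup>2)) *\<^sub>R u\<^sub>2)) / c\<^sup>2)"
      by (simp add: galilei_def lorentz_def Let_def \<gamma>\<^sub>1_def \<gamma>\<^sub>2_def t_def x_def)
    also have "\<dots> = (\<gamma>\<^sub>1 * \<gamma>\<^sub>2) * (t - (step_velocity c u\<^sub>1 u\<^sub>2 \<bullet> x) / c\<^sup>2)"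
      using g0 unfolding step_velocity_def \<gamma>\<^sub>2_def[symmetric]
      by (simp add: inner_add_left inner_add_right inner_diff_right inner_commute[of _ u\<^sub>1] divide_simps)
         (simp add: algebra_simps inner_commute)
    also have "\<dots> = ?R \<bullet> X"
      by (simp add: inner_event \<gamma>\<^sub>1_def \<gamma>\<^sub>2_def t_def x_def divide_simps)
    finally show ?thesis .
  qed
  then show ?thesis
    by (rule vector_eq_rdot[THEN iffD1, OF allI])
qed

text \<open>The definite description has a unique solution because \<open>c\<close> and both Lorentz
  factors are nonzero, so the velocity can be recovered from the time row.\<close>

lemma two_step_velocity_eq:
  fixes u\<^sub>1 u\<^sub>2 :: "real ^ 'n::finite"
  assumes "norm u\<^sub>1 < c" "norm u\<^sub>2 < c"
  shows "two_step_velocity c u\<^sub>1 u\<^sub>2 = step_velocity c u\<^sub>1 u\<^sub>2"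
proof -
  have "c > 0"
    using assms(1) norm_ge_zero[of u\<^sub>1] by linarith
  moreover have "lorentz_factor c u\<^sub>1 \<noteq> 0" "lorentz_factor c u\<^sub>2 \<noteq> 0"
    using lorentz_factor_pos assms by (metis less_irrefl)+
  ultimately show ?thesis
    unfolding two_step_velocity_def row_None_inv_two_step[OF assms]
    by (intro the_equality) (simp_all add: event_eq_iff)
qed

section \<open>The quadratic form of the time row and the value of \<open>q00\<close>\<close>

lemma Q_star_form:
  "(V ** Q_star c ** transpose V) $ None $ None =
    (time_part (row None V))\<^sup>2 - c\<^sup>2 * (norm (space_part (row None V)))\<^sup>2"
proof -
  \<comment> \<open>\<open>Q_star c\<close> is diagonal: multiplying by it merely rescales the
    columns, and the double sum collapses to a single one.\<close>
  have row: "(V ** Q_star c) $ None $ j = V $ None $ j * (if j = None then 1 else - c\<^sup>2)" for j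
    by (simp add: matrix_matrix_mult_def Q_star_def if_distrib[of "\<lambda>y. _ * y"] cong: if_cong)
  have "(V ** Q_star c ** transpose V) $ None $ None
      = (\<Sum>j\<in>UNIV. V $ None $ j * (if j = None then 1 else - c\<^sup>2) * V $ None $ j)"
    unfolding matrix_matrix_mult_def[of "V ** Q_star c"] by (simp add: row transpose_def)
  also have "\<dots> = (time_part (row None V))\<^sup>2 - c\<^sup>2 * (norm (space_part (row None V)))\<^sup>2"
    by (simp add: sum_UNIV_option time_part_def space_part_def row_def power2_norm_eq_inner)
       (simp add: inner_vec_def power2_eq_square sum_distrib_left sum_negf algebra_simps)
  finally show ?thesis .
qed

text \<open>The velocity is a combination \<open>q *\<^sub>R n + k *\<^sub>R u\<^sub>1\<close> with
  \<open>k = 1 / \<gamma>\<^sub>2\<close>. Expanding its square and inserting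
  \<open>k\<^sup>2 = 1 - r\<^sup>2 / c\<^sup>2\<close> gives the factorization.\<close>

lemma step_velocity_norm:
  fixes u\<^sub>1 u\<^sub>2 :: "real ^ 'n::finite"
  assumes "norm u\<^sub>2 < c"
  shows "1 - (norm (step_velocity c u\<^sub>1 u\<^sub>2))\<^sup>2 / c\<^sup>2
    = (1 - (norm u\<^sub>2)\<^sup>2 / c\<^sup>2) * ((1 - (u\<^sub>1 \<bullet> u\<^sub>2) / c\<^sup>2)\<^sup>2 - (norm u\<^sub>1)\<^sup>2 / c\<^sup>2)"
proof -
  have c: "c > 0"
    using assms norm_ge_zero[of u\<^sub>2] by linarith
  define k where "k = 1 / lorentz_factor c u\<^sub>2"
  define n r p where "n = sgn u\<^sub>2" and "r = norm u\<^sub>2" and "p = n \<bullet> u\<^sub>1"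
  have k2: "k\<^sup>2 = 1 - r\<^sup>2 / c\<^sup>2"
    using norm_ratio_less_one[OF assms] by (simp add: k_def lorentz_factor_def r_def)
  have u2: "u\<^sub>2 = r *\<^sub>R n"
    by (cases "u\<^sub>2 = 0") (simp_all add: n_def r_def sgn_div_norm)
  \<comment> \<open>The second alternative is \<open>u\<^sub>2 = 0\<close>, where
    \<open>sgn u\<^sub>2 = 0\<close>; then \<open>q = 0\<close>, so
    \<open>q\<^sup>2 * (n \<bullet> n) = q\<^sup>2\<close> still holds.\<close>
  have nn: "n \<bullet> n = 1 \<or> (r = 0 \<and> p = 0 \<and> n = 0)"
    by (cases "u\<^sub>2 = 0") (simp_all add: n_def r_def p_def norm_eq_1[symmetric] norm_sgn)
  define a where "a = r * p / c\<^sup>2"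
  have a: "(u\<^sub>1 \<bullet> u\<^sub>2) / c\<^sup>2 = a"
    by (simp add: a_def u2 p_def inner_commute)
  have w: "step_velocity c u\<^sub>1 u\<^sub>2 = ((1 - a) * r + (1 - k) * p) *\<^sub>R n + k *\<^sub>R u\<^sub>1"
    unfolding step_velocity_def a n_def[symmetric] p_def[symmetric]
    by (simp add: u2 k_def inverse_eq_divide algebra_simps)
  define q where "q = (1 - a) * r + (1 - k) * p"
  have "(norm (step_velocity c u\<^sub>1 u\<^sub>2))\<^sup>2 = q\<^sup>2 * (n \<bullet> n) + 2 * q * k * p + k\<^sup>2 * (u\<^sub>1 \<bullet> u\<^sub>1)"
    unfolding w q_def[symmetric] power2_norm_eq_inner
    by (simp add: inner_add_left inner_add_right p_def inner_commute power2_eq_square algebra_simps)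
  also have "\<dots> = q\<^sup>2 + 2 * q * k * p + k\<^sup>2 * (u\<^sub>1 \<bullet> u\<^sub>1)"
    using nn by (auto simp: q_def)
  \<comment> \<open>Completing the square: \<open>q + k * p = (1 - a) * r + p\<close>, so
    \<open>k\<close> survives only through \<open>k\<^sup>2\<close>.\<close>
  also have "\<dots> = ((1 - a) * r + p)\<^sup>2 - k\<^sup>2 * p\<^sup>2 + k\<^sup>2 * (norm u\<^sub>1)\<^sup>2"
    unfolding q_def power2_norm_eq_inner by algebra
  finally have N: "(norm (step_velocity c u\<^sub>1 u\<^sub>2))\<^sup>2
      = ((1 - a) * r + p)\<^sup>2 - k\<^sup>2 * p\<^sup>2 + k\<^sup>2 * (norm u\<^sub>1)\<^sup>2" .
  show ?thesis
    unfolding N k2 a r_def[symmetric] using c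
    by (simp add: a_def field_simps power2_eq_square)
qed

text \<open>The time row has the form \<open>g * (1, - w / c\<^sup>2)\<close>, so \<open>q00\<close>
  is \<open>g\<^sup>2 * (1 - |w|\<^sup>2 / c\<^sup>2)\<close>. The factor
  \<open>1 - b\<^sub>2\<close> from \<open>step_velocity_norm\<close> cancels against the second
  Lorentz factor; the remaining asymmetry is what the exchange of steps detects.\<close>

lemma q00_eq:
  fixes u\<^sub>1 u\<^sub>2 :: "real ^ 'n::finite"
  assumes "norm u\<^sub>1 < c" "norm u\<^sub>2 < c"
  shows "q00 c u\<^sub>1 u\<^sub>2 =
    ((1 - (u\<^sub>1 \<bullet> u\<^sub>2) / c\<^sup>2)\<^sup>2 - (norm u\<^sub>1)\<^sup>2 / c\<^sup>2) / (1 - (norm u\<^sub>1)\<^sup>2 / c\<^sup>2)"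
proof -
  have c: "c > 0"
    using assms(1) norm_ge_zero[of u\<^sub>1] by linarith
  define g w where "g = lorentz_factor c u\<^sub>1 * lorentz_factor c u\<^sub>2" and "w = step_velocity c u\<^sub>1 u\<^sub>2"
  define b\<^sub>1 b\<^sub>2 where "b\<^sub>1 = (norm u\<^sub>1)\<^sup>2 / c\<^sup>2" and "b\<^sub>2 = (norm u\<^sub>2)\<^sup>2 / c\<^sup>2"
  have b: "b\<^sub>1 < 1" "b\<^sub>2 < 1"
    unfolding b\<^sub>1_def b\<^sub>2_def by (intro norm_ratio_less_one assms)+
  have g2: "g\<^sup>2 = 1 / ((1 - b\<^sub>1) * (1 - b\<^sub>2))"
  proof -
    have "g\<^sup>2 * ((1 - b\<^sub>1) * (1 - b\<^sub>2)) = 1"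
      using lorentz_factor_square[OF assms(1)] lorentz_factor_square[OF assms(2)]
      unfolding g_def b\<^sub>1_def[symmetric] b\<^sub>2_def[symmetric] power_mult_distrib
      by (metis mult.assoc mult.left_commute mult_1_right)
    moreover have "(1 - b\<^sub>1) * (1 - b\<^sub>2) \<noteq> 0"
      using b by simp
    ultimately show ?thesis
      by (metis nonzero_eq_divide_eq)
  qed
  have "q00 c u\<^sub>1 u\<^sub>2 = g\<^sup>2 - c\<^sup>2 * (norm (g *\<^sub>R (w /\<^sub>R c\<^sup>2)))\<^sup>2"
    unfolding q00_def Let_def Q_star_form row_None_inv_two_step[OF assms] scaleR_event
    by (simp add: g_def w_def)
  also have "\<dots> = g\<^sup>2 * (1 - (norm w)\<^sup>2 / c\<^sup>2)"
    using c by (simp add: power_mult_distrib power_divide field_simps power2_eq_square abs_mult)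
  also have "\<dots> = ((1 - (u\<^sub>1 \<bullet> u\<^sub>2) / c\<^sup>2)\<^sup>2 - b\<^sub>1) / (1 - b\<^sub>1)"
    using b unfolding w_def step_velocity_norm[OF assms(2)] g2 b\<^sub>1_def[symmetric] b\<^sub>2_def[symmetric]
    by simp
  finally show ?thesis
    by (simp add: b\<^sub>1_def)
qed

lemma q00_eq_D_fun:
  fixes u\<^sub>1 u\<^sub>2 :: "real ^ 'n::finite"
  assumes "norm u\<^sub>1 < c" "norm u\<^sub>2 < c"
  shows "q00 c u\<^sub>1 u\<^sub>2 = D_fun c u\<^sub>1 u\<^sub>2 (norm u\<^sub>1) / (c\<^sup>2 * (c\<^sup>2 - (norm u\<^sub>1)\<^sup>2))"
proof -
  have c: "c > 0"
    using assms(1) norm_ge_zero[of u\<^sub>1] by linarith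
  have "(norm u\<^sub>1)\<^sup>2 < c\<^sup>2"
    using norm_ratio_less_one[OF assms(1)] c by (simp add: divide_simps)
  then have e: "c\<^sup>2 - (norm u\<^sub>1)\<^sup>2 \<noteq> 0"
    by linarith
  have "1 - (norm u\<^sub>1)\<^sup>2 / c\<^sup>2 = (c\<^sup>2 - (norm u\<^sub>1)\<^sup>2) / c\<^sup>2"
    using c by (simp add: diff_divide_distrib)
  moreover have "(1 - (u\<^sub>1 \<bullet> u\<^sub>2) / c\<^sup>2)\<^sup>2 - (norm u\<^sub>1)\<^sup>2 / c\<^sup>2 = D_fun c u\<^sub>1 u\<^sub>2 (norm u\<^sub>1) / (c\<^sup>2 * c\<^sup>2)"
  proof -
    have "(1 - s / e)\<^sup>2 - n / e = ((e - s)\<^sup>2 - e * n) / (e * e)" if "e \<noteq> 0" for e s n :: real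
      using that by (simp add: power2_eq_square field_simps)
    then show ?thesis
      using c by (simp only: D_fun_def) simp
  qed
  ultimately show ?thesis
    using c e unfolding q00_eq[OF assms] by (simp add: power2_eq_square)
qed

section \<open>The exact exchange ratio and orthogonal steps\<close>

lemma D_fun_commute: "D_fun c u\<^sub>1 u\<^sub>2 = D_fun c u\<^sub>2 u\<^sub>1"
  by (simp add: D_fun_def fun_eq_iff inner_commute)

text \<open>The ratio is the square root of the inverted quotient of the two values of
  \<open>q00\<close>; the common factor \<open>c\<^sup>2\<close> cancels, and \<open>D_fun\<close>
  is symmetric in the two velocities.\<close>

lemma dilation_ratio:
  fixes u\<^sub>1 u\<^sub>2 :: "real ^ 'n::finite"
  assumes "norm u\<^sub>1 < c" "norm u\<^sub>2 < c"
  shows "dilation c u\<^sub>1 u\<^sub>2 / dilation c u\<^sub>2 u\<^sub>1 =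
    sqrt ((D_fun c u\<^sub>1 u\<^sub>2 (norm u\<^sub>2) * (c\<^sup>2 - (norm u\<^sub>1)\<^sup>2)) /
          (D_fun c u\<^sub>1 u\<^sub>2 (norm u\<^sub>1) * (c\<^sup>2 - (norm u\<^sub>2)\<^sup>2)))"
proof -
  have "c > 0"
    using assms(1) norm_ge_zero[of u\<^sub>1] by linarith
  have cancel: "(E / (c\<^sup>2 * f)) / (D / (c\<^sup>2 * e)) = (E * e) / (D * f)" for D E e f
    using \<open>c > 0\<close> by simp
  have "dilation c u\<^sub>1 u\<^sub>2 / dilation c u\<^sub>2 u\<^sub>1 = sqrt (q00 c u\<^sub>2 u\<^sub>1 / q00 c u\<^sub>1 u\<^sub>2)"
    by (simp add: dilation_def real_sqrt_divide)
  then show ?thesis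
    unfolding q00_eq_D_fun[OF assms] q00_eq_D_fun[OF assms(2,1)] D_fun_commute[of c u\<^sub>2] cancel .
qed

text \<open>A vanishing inner product turns the denominator of the Einstein sum into 1 and makes
  numerator and denominator of \<open>q00\<close> equal.\<close>

lemma orthogonal_two_step:
  fixes u\<^sub>1 u\<^sub>2 :: "real ^ 'n::finite"
  assumes "norm u\<^sub>1 < c" "norm u\<^sub>2 < c" "u\<^sub>1 \<bullet> u\<^sub>2 = 0"
  shows "two_step_velocity c u\<^sub>1 u\<^sub>2 = einstein_add c u\<^sub>2 u\<^sub>1" and "q00 c u\<^sub>1 u\<^sub>2 = 1"
proof -
  have "1 - (norm u\<^sub>1)\<^sup>2 / c\<^sup>2 \<noteq> 0"
    using norm_ratio_less_one[OF assms(1)] by linarith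
  then show "q00 c u\<^sub>1 u\<^sub>2 = 1"
    unfolding q00_eq[OF assms(1,2)] assms(3) by (simp only: div_by_1 div_0 diff_zero one_power2 divide_self not_False_eq_True)
  show "two_step_velocity c u\<^sub>1 u\<^sub>2 = einstein_add c u\<^sub>2 u\<^sub>1"
    using assms by (simp add: two_step_velocity_eq step_velocity_def einstein_add_def inner_commute)
qed

section \<open>Real estimates behind the expansion of the ratio\<close>

lemma sqrt_one_plus_bound:
  assumes "X \<ge> -1"
  shows "\<bar>sqrt (1 + X) - 1 - X / 2\<bar> \<le> X\<^sup>2 / 2"
proof -
  \<comment> \<open>In terms of \<open>y\<close> the error is exactly
    \<open>- y\<^sup>2 / 2\<close>, and \<open>y + 2 \<ge> 1\<close> yields
    \<open>|y| \<le> |X|\<close>.\<close>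
  define y where "y = sqrt (1 + X) - 1"
  have y: "y \<ge> -1" and X: "X = y * (y + 2)"
    using assms by (simp_all add: y_def algebra_simps)
  have "\<bar>y\<bar> * 1 \<le> \<bar>y\<bar> * (y + 2)"
    using y by (intro mult_left_mono) auto
  then have "\<bar>y\<bar> \<le> \<bar>X\<bar>"
    using y by (simp add: X abs_mult)
  then have "y\<^sup>2 \<le> X\<^sup>2"
    by (simp add: abs_le_square_iff)
  moreover have "sqrt (1 + X) - 1 - X / 2 = - (y\<^sup>2 / 2)"
    unfolding y_def[symmetric] by (simp add: X power2_eq_square algebra_simps)
  ultimately show ?thesis
    by simp
qed

text \<open>Here \<open>m\<close> plays the role of the squared speed ratio, so the error is of
  sixth order in the speeds. The ratio is \<open>sqrt (1 + X)\<close> with \<open>X\<close> of order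
  \<open>m\<^sup>2\<close>; linearizing the root costs at most \<open>18 * m ^ 3\<close> and
  replacing \<open>X / 2\<close> by the leading term \<open>16 * m ^ 3\<close>, so 100 leaves
  slack.\<close>

lemma sqrt_ratio_expansion:
  fixes a b\<^sub>1 b\<^sub>2 m :: real
  assumes a: "\<bar>a\<bar> \<le> m" and b: "0 \<le> b\<^sub>1" "b\<^sub>1 \<le> m" "0 \<le> b\<^sub>2" "b\<^sub>2 \<le> m" and m: "m \<le> 1 / 16"
  shows "\<bar>sqrt ((((1 - a)\<^sup>2 - b\<^sub>2) / (1 - b\<^sub>2)) / (((1 - a)\<^sup>2 - b\<^sub>1) / (1 - b\<^sub>1))) - 1 - (b\<^sub>1 - b\<^sub>2) * a\<bar>
    \<le> 100 * m ^ 3"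
proof -
  define N where "N = ((1 - a)\<^sup>2 - b\<^sub>1) * (1 - b\<^sub>2)"
  define X where "X = (b\<^sub>1 - b\<^sub>2) * (2 * a - a\<^sup>2) / N"
  have m0: "m \<ge> 0"
    using b by linarith
  have aa: "\<bar>a * a\<bar> \<le> m" and bb: "\<bar>b\<^sub>1 * b\<^sub>2\<bar> \<le> m"
    using mult_mono[OF a a] mult_mono[of b\<^sub>1 m b\<^sub>2 m] mult_right_mono[of m 1 m] a b m m0
    by (simp_all add: abs_mult)
  have k: "0 \<le> (1 - a)\<^sup>2" "(1 - a)\<^sup>2 \<le> 2"
  proof -
    have "(1 - a)\<^sup>2 = 1 - 2 * a + a * a"
      by (simp add: power2_eq_square algebra_simps)
    then show "(1 - a)\<^sup>2 \<le> 2"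
      using a m aa by linarith
  qed simp
  have kb: "\<bar>(1 - a)\<^sup>2 * b\<^sub>2\<bar> \<le> 2 * m"
    using mult_mono[OF k(2) b(4)] k b by (simp add: abs_mult)
  have N1: "\<bar>1 - N\<bar> \<le> 7 * m"
  proof -
    \<comment> \<open>The five terms contribute at most 2, 1, 1, 2 and 1 times \<open>m\<close>.
      Since \<open>7 / 16 < 1 / 2\<close>, this keeps \<open>N\<close> above
      \<open>1 / 2\<close>.\<close>
    have "1 - N = 2 * a - a * a + b\<^sub>1 + (1 - a)\<^sup>2 * b\<^sub>2 - b\<^sub>1 * b\<^sub>2"
      by (simp add: N_def power2_eq_square algebra_simps)
    then show ?thesis
      using a aa bb kb b by linarith
  qed
  then have N: "N \<ge> 1 / 2"
    using m by linarith
  have bd: "\<bar>b\<^sub>1 - b\<^sub>2\<bar> \<le> m"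
    using b by linarith
  have "\<bar>2 * a - a\<^sup>2\<bar> \<le> 3 * m"
    using a aa zero_le_square[of a] unfolding power2_eq_square by linarith
  then have num: "\<bar>(b\<^sub>1 - b\<^sub>2) * (2 * a - a\<^sup>2)\<bar> \<le> m * (3 * m)"
    unfolding abs_mult by (intro mult_mono bd) (auto simp: m0)
  have X: "\<bar>X\<bar> \<le> 6 * m\<^sup>2"
  proof -
    have "\<bar>X\<bar> = \<bar>(b\<^sub>1 - b\<^sub>2) * (2 * a - a\<^sup>2)\<bar> / N"
      using N by (simp add: X_def abs_mult)
    also have "\<dots> \<le> (m * (3 * m)) / (1 / 2)"
      by (intro frac_le num N) auto
    finally show ?thesis
      by (simp add: power2_eq_square)
  qed
  have m2: "m\<^sup>2 \<le> 1 / 256"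
    using power_mono[OF m m0, of 2] by (simp add: power2_eq_square)
  have X1: "X \<ge> -1"
    using X m2 by linarith
  have ratio: "(((1 - a)\<^sup>2 - b\<^sub>2) / (1 - b\<^sub>2)) / (((1 - a)\<^sup>2 - b\<^sub>1) / (1 - b\<^sub>1)) = 1 + X"
  proof -
    have nz: "1 - b\<^sub>1 \<noteq> 0" "1 - b\<^sub>2 \<noteq> 0" "N \<noteq> 0"
      using b m N by linarith+
    then have "(((1 - a)\<^sup>2 - b\<^sub>2) / (1 - b\<^sub>2)) / (((1 - a)\<^sup>2 - b\<^sub>1) / (1 - b\<^sub>1))
        = ((1 - a)\<^sup>2 - b\<^sub>2) * (1 - b\<^sub>1) / N"
      by (simp add: N_def mult.commute)
    also have "\<dots> = (N + (b\<^sub>1 - b\<^sub>2) * (2 * a - a\<^sup>2)) / N"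
      by (simp add: N_def power2_eq_square algebra_simps)
    also have "\<dots> = 1 + X"
      using nz by (simp add: X_def add_divide_distrib)
    finally show ?thesis .
  qed
  \<comment> \<open>The part linear in \<open>a\<close> survives only with the factor
    \<open>1 - N\<close>, itself of order \<open>m\<close>; hence the whole difference is of third
    order in \<open>m\<close>.\<close>
  have "X / 2 - (b\<^sub>1 - b\<^sub>2) * a = (b\<^sub>1 - b\<^sub>2) * (a * (1 - N) - a * a / 2) / N"
    using N by (simp add: X_def power2_eq_square field_simps)
  moreover have "\<bar>(b\<^sub>1 - b\<^sub>2) * (a * (1 - N) - a * a / 2)\<bar> \<le> m * (8 * m\<^sup>2)"
  proof -
    have "\<bar>a * (1 - N)\<bar> \<le> m * (7 * m)" "\<bar>a * a\<bar> \<le> m * m"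
      unfolding abs_mult using a m0 by (intro mult_mono N1; simp)+
    then have "\<bar>a * (1 - N) - a * a / 2\<bar> \<le> 8 * m\<^sup>2"
      using zero_le_square[of m] unfolding power2_eq_square by linarith
    then show ?thesis
      unfolding abs_mult by (intro mult_mono bd) (auto simp: m0)
  qed
  ultimately have "\<bar>X / 2 - (b\<^sub>1 - b\<^sub>2) * a\<bar> \<le> m * (8 * m\<^sup>2) / (1 / 2)"
    using N by (simp only: abs_divide) (intro frac_le; simp)
  then have 1: "\<bar>X / 2 - (b\<^sub>1 - b\<^sub>2) * a\<bar> \<le> 16 * m ^ 3"
    by (simp add: power2_eq_square power3_eq_cube)
  have "X\<^sup>2 \<le> (6 * m\<^sup>2)\<^sup>2"
    using X by (intro abs_le_square_iff[THEN iffD1]) simp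
  also have "\<dots> = 36 * (m * m ^ 3)"
    by (simp add: power_mult_distrib power3_eq_cube power2_eq_square)
  also have "\<dots> \<le> 36 * (1 * m ^ 3)"
    using m m0 by (intro mult_left_mono mult_right_mono) auto
  finally have 2: "X\<^sup>2 / 2 \<le> 18 * m ^ 3"
    by simp
  have "m ^ 3 \<ge> 0"
    using m0 by simp
  then show ?thesis
    unfolding ratio using sqrt_one_plus_bound[OF X1] 1 2 by linarith
qed

section \<open>The fourth-order term of the exchange ratio\<close>

definition exchange_term :: "real \<Rightarrow> (real ^ 'n::finite) \<times> (real ^ 'n) \<Rightarrow> real"
  where "exchange_term c z = ((norm (fst z))\<^sup>2 / c\<^sup>2 - (norm (snd z))\<^sup>2 / c\<^sup>2) * ((fst z \<bullet> snd z) / c\<^sup>2)"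

text \<open>Written out in coordinates, the squared norms and the inner product are sums of products
  of linear functionals on the pair; each of them is of degree two.\<close>

lemma homogeneous_exchange_term:
  "homogeneous_polynomial 4 (exchange_term c :: (real ^ 'n::finite) \<times> (real ^ 'n) \<Rightarrow> real)"
proof -
  have comp: "real_polynomial_function (\<lambda>z :: (real ^ 'n) \<times> (real ^ 'n). fst z $ i)"
       "real_polynomial_function (\<lambda>z :: (real ^ 'n) \<times> (real ^ 'n). snd z $ i)" for i
    by (intro real_polynomial_function.intros(1) bounded_linear_compose[OF bounded_linear_vec_nth]
        bounded_linear_fst bounded_linear_snd)+
  have "real_polynomial_function (exchange_term c :: (real ^ 'n) \<times> (real ^ 'n) \<Rightarrow> real)"
    unfolding exchange_term_def power2_norm_eq_inner inner_vec_def inner_real_def divide_inverse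
    by (intro real_polynomial_function.intros(2-) real_polynomial_function_diff
        real_polynomial_function_sum comp) auto
  moreover have "exchange_term c (s *\<^sub>R z) = s ^ 4 * exchange_term c z"
    for s and z :: "(real ^ 'n) \<times> (real ^ 'n)"
    by (simp add: exchange_term_def power2_norm_eq_inner power4_eq_xxxx
        power2_eq_square[of s] algebra_simps)
  ultimately show ?thesis
    by (simp add: homogeneous_polynomial_def)
qed

lemma exchange_term_nonzero:
  assumes "c > 0"
  shows "\<exists>z :: (real ^ 'n::finite) \<times> (real ^ 'n). exchange_term c z \<noteq> 0"
proof -
  fix i :: 'n
  \<comment> \<open>Parallel vectors of different lengths make both factors nonzero.\<close>
  have "exchange_term c (2 *\<^sub>R axis i 1 :: real ^ 'n, axis i 1) \<noteq> 0"
    using assms by (simp add: exchange_term_def inner_axis)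
  then show ?thesis
    by blast
qed

section \<open>Asymptotics for slow velocities\<close>

lemma eventually_slow:
  fixes P :: "(real ^ 'n) \<times> (real ^ 'n) \<Rightarrow> bool"
  assumes "\<And>z. 0 < max_speed_ratio c z \<Longrightarrow> max_speed_ratio c z < \<delta> \<Longrightarrow> P z" "\<delta> > 0"
  shows "eventually P (slow c)"
  unfolding slow_def eventually_filtercomap eventually_at_right_field
  using assms by (intro exI[of _ "\<lambda>M. 0 < M \<and> M < \<delta>"]) auto

lemma filterlim_max_speed_ratio: "(max_speed_ratio c \<longlongrightarrow> 0) (slow c)"
proof -
  have "filterlim (max_speed_ratio c) (at_right 0) (slow c)"
    unfolding slow_def by (rule filterlim_filtercomap)
  then show ?thesis
    unfolding filterlim_at by (elim conjE)
qed

text \<open>These supply the hypotheses of \<open>sqrt_ratio_expansion\<close> with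
  \<open>m = M\<^sup>2\<close>; the bound on the inner product is Cauchy-Schwarz.\<close>

lemma slow_bounds:
  fixes u\<^sub>1 u\<^sub>2 :: "real ^ 'n::finite"
  assumes "c > 0" and M: "max_speed_ratio c (u\<^sub>1, u\<^sub>2) = M"
  shows "(norm u\<^sub>1)\<^sup>2 / c\<^sup>2 \<le> M\<^sup>2" "(norm u\<^sub>2)\<^sup>2 / c\<^sup>2 \<le> M\<^sup>2" "\<bar>(u\<^sub>1 \<bullet> u\<^sub>2) / c\<^sup>2\<bar> \<le> M\<^sup>2"
    and "M < 1 \<Longrightarrow> norm u\<^sub>1 < c" "M < 1 \<Longrightarrow> norm u\<^sub>2 < c"
proof -
  have n: "norm u\<^sub>1 / c \<le> M" "norm u\<^sub>2 / c \<le> M" "0 \<le> norm u\<^sub>1 / c" "0 \<le> norm u\<^sub>2 / c"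
    using assms(1) M[symmetric] by (simp_all add: max_speed_ratio_def divide_right_mono)
  show "(norm u\<^sub>1)\<^sup>2 / c\<^sup>2 \<le> M\<^sup>2" "(norm u\<^sub>2)\<^sup>2 / c\<^sup>2 \<le> M\<^sup>2"
    using power_mono[OF n(1,3), of 2] power_mono[OF n(2,4), of 2] by (simp_all add: power_divide)
  have "\<bar>(u\<^sub>1 \<bullet> u\<^sub>2) / c\<^sup>2\<bar> \<le> (norm u\<^sub>1 * norm u\<^sub>2) / c\<^sup>2"
    using Cauchy_Schwarz_ineq2[of u\<^sub>1 u\<^sub>2] by (simp add: divide_right_mono)
  also have "\<dots> = (norm u\<^sub>1 / c) * (norm u\<^sub>2 / c)"
    by (simp add: power2_eq_square)
  also have "\<dots> \<le> M * M"
    using n by (intro mult_mono) auto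
  finally show "\<bar>(u\<^sub>1 \<bullet> u\<^sub>2) / c\<^sup>2\<bar> \<le> M\<^sup>2"
    by (simp add: power2_eq_square)
  show "M < 1 \<Longrightarrow> norm u\<^sub>1 < c" "M < 1 \<Longrightarrow> norm u\<^sub>2 < c"
    using le_less_trans[OF n(1), of 1] le_less_trans[OF n(2), of 1] assms(1) by simp_all
qed

text \<open>The numerator of \<open>q00\<close> is positive because
  \<open>(1 - a)\<^sup>2 \<ge> (15 / 16)\<^sup>2\<close>, whereas the subtracted term is at most
  \<open>1 / 16\<close>.\<close>

lemma slow_dilation_defined:
  fixes u\<^sub>1 u\<^sub>2 :: "real ^ 'n::finite"
  assumes "c > 0" "max_speed_ratio c (u\<^sub>1, u\<^sub>2) < 1 / 4"
  shows "dilation_defined c u\<^sub>1 u\<^sub>2"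
proof -
  define M where "M = max_speed_ratio c (u\<^sub>1, u\<^sub>2)"
  note bounds = slow_bounds[OF assms(1) M_def[symmetric]]
  have "M \<ge> 0"
    using assms(1) by (simp add: M_def max_speed_ratio_def le_max_iff_disj)
  then have M2: "M\<^sup>2 \<le> 1 / 16"
    using assms(2) power_mono[of M "1 / 4" 2] by (simp add: M_def power2_eq_square)
  have less: "norm u\<^sub>1 < c" "norm u\<^sub>2 < c"
    using bounds(4,5) assms(2) by (simp_all add: M_def)
  define a where "a = (u\<^sub>1 \<bullet> u\<^sub>2) / c\<^sup>2"
  have "(15 / 16)\<^sup>2 \<le> (1 - a)\<^sup>2"
    using bounds(3) M2 unfolding a_def[symmetric] by (intro power_mono) auto
  then show ?thesis
    using bounds(1) M2 norm_ratio_less_one[OF less(1)]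
    unfolding dilation_defined_def q00_eq[OF less] a_def[symmetric]
    by (intro divide_pos_pos) (simp_all add: power2_eq_square)
qed

text \<open>The threshold \<open>1 / 4\<close> is the square root of the bound \<open>1 / 16\<close>
  on \<open>m = M\<^sup>2\<close>, and \<open>m ^ 3\<close> becomes \<open>M ^ 6\<close>.\<close>

lemma exchange_ratio_expansion:
  fixes z :: "(real ^ 'n::finite) \<times> (real ^ 'n)"
  assumes "c > 0" "max_speed_ratio c z < 1 / 4"
  shows "\<bar>exchange_ratio c z - 1 - exchange_term c z\<bar> \<le> 100 * max_speed_ratio c z ^ 6"
proof -
  obtain u\<^sub>1 u\<^sub>2 where z: "z = (u\<^sub>1, u\<^sub>2)"
    by (cases z)
  define M where "M = max_speed_ratio c (u\<^sub>1, u\<^sub>2)"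
  note bounds = slow_bounds[OF assms(1) M_def[symmetric]]
  have "M \<ge> 0"
    using assms(1) by (simp add: M_def max_speed_ratio_def le_max_iff_disj)
  then have M2: "M\<^sup>2 \<le> 1 / 16"
    using assms(2) power_mono[of M "1 / 4" 2] by (simp add: M_def z power2_eq_square)
  have less: "norm u\<^sub>1 < c" "norm u\<^sub>2 < c"
    using bounds(4,5) assms(2) by (simp_all add: M_def z)
  have "exchange_ratio c z = sqrt (q00 c u\<^sub>2 u\<^sub>1 / q00 c u\<^sub>1 u\<^sub>2)"
    by (simp add: exchange_ratio_def z dilation_def real_sqrt_divide)
  then show ?thesis
    using sqrt_ratio_expansion[OF bounds(3) _ bounds(1) _ bounds(2) M2]
    by (simp add: q00_eq less inner_commute[of u\<^sub>2] exchange_term_def z M_def[symmetric] power_mult[symmetric])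
qed

lemma exchange_ratio_smallo:
  assumes "c > 0"
  shows "(\<lambda>z :: (real ^ 'n::finite) \<times> (real ^ 'n). exchange_ratio c z - 1 - exchange_term c z)
    \<in> o[slow c](\<lambda>z. max_speed_ratio c z ^ 4)"
proof (rule landau_o.big_small_trans)
  show "(\<lambda>z :: (real ^ 'n) \<times> (real ^ 'n). exchange_ratio c z - 1 - exchange_term c z)
    \<in> O[slow c](\<lambda>z. max_speed_ratio c z ^ 6)"
  proof (rule bigoI)
    show "\<forall>\<^sub>F z :: (real ^ 'n) \<times> (real ^ 'n) in slow c.
        norm (exchange_ratio c z - 1 - exchange_term c z) \<le> 100 * norm (max_speed_ratio c z ^ 6)"
      by (rule eventually_slow[of _ "1 / 4"]) (use exchange_ratio_expansion[OF assms] in auto)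
  qed
  have "((\<lambda>z. max_speed_ratio c z ^ 2) \<longlongrightarrow> 0) (slow c :: ((real ^ 'n) \<times> (real ^ 'n)) filter)"
    using tendsto_power[OF filterlim_max_speed_ratio, of c 2] by simp
  then show "(\<lambda>z :: (real ^ 'n) \<times> (real ^ 'n). max_speed_ratio c z ^ 6)
      \<in> o[slow c](\<lambda>z. max_speed_ratio c z ^ 4)"
  proof (intro smalloI_tendsto)
    assume "((\<lambda>z. max_speed_ratio c z ^ 2) \<longlongrightarrow> 0) (slow c :: ((real ^ 'n) \<times> (real ^ 'n)) filter)"
    then show "((\<lambda>z :: (real ^ 'n) \<times> (real ^ 'n). max_speed_ratio c z ^ 6 / max_speed_ratio c z ^ 4)
        \<longlongrightarrow> 0) (slow c)"
      by (rule Lim_transform_eventually)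
         (rule eventually_slow[of _ 1], simp_all add: power_diff[symmetric])
    \<comment> \<open>The filter is pulled back from \<open>at_right 0\<close>, so the speed ratio
      is eventually strictly positive.\<close>
    show "\<forall>\<^sub>F z :: (real ^ 'n) \<times> (real ^ 'n) in slow c. max_speed_ratio c z ^ 4 \<noteq> 0"
      by (rule eventually_slow[of _ 1]) auto
  qed
qed

lemma exchange_term_bigo:
  assumes "c > 0"
  shows "(exchange_term c :: (real ^ 'n::finite) \<times> (real ^ 'n) \<Rightarrow> real)
    \<in> O[slow c](\<lambda>z. max_speed_ratio c z ^ 4)"
proof (rule bigoI[of _ 1], rule eventually_slow[of _ 1])
  fix z :: "(real ^ 'n) \<times> (real ^ 'n)"
  obtain u\<^sub>1 u\<^sub>2 where z: "z = (u\<^sub>1, u\<^sub>2)"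
    by (cases z)
  define M where "M = max_speed_ratio c (u\<^sub>1, u\<^sub>2)"
  note bounds = slow_bounds[OF assms(1) M_def[symmetric]]
  \<comment> \<open>Both terms lie between 0 and \<open>M\<^sup>2\<close>, hence so does the
    absolute value of their difference.\<close>
  have "\<bar>(norm u\<^sub>1)\<^sup>2 / c\<^sup>2 - (norm u\<^sub>2)\<^sup>2 / c\<^sup>2\<bar> \<le> M\<^sup>2"
    using bounds(1,2) zero_le_power2[of "norm u\<^sub>1 / c"] zero_le_power2[of "norm u\<^sub>2 / c"]
    unfolding power_divide by linarith
  then have "\<bar>exchange_term c z\<bar> \<le> M\<^sup>2 * M\<^sup>2"
    unfolding exchange_term_def z fst_conv snd_conv abs_mult by (intro mult_mono bounds(3)) auto
  then show "norm (exchange_term c z) \<le> 1 * norm (max_speed_ratio c z ^ 4)"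
    by (simp add: z M_def[symmetric] power_add[symmetric])
qed simp

theorem corollary23:
  fixes c :: real
  assumes "c > 0" and "CARD('n::finite) \<in> {2, 3}"
  shows "(\<forall>u\<^sub>1 u\<^sub>2 :: real ^ 'n. norm u\<^sub>1 < c \<longrightarrow> norm u\<^sub>2 < c \<longrightarrow> u\<^sub>1 \<bullet> u\<^sub>2 = 0 \<longrightarrow>
           two_step_velocity c u\<^sub>1 u\<^sub>2 = einstein_add c u\<^sub>2 u\<^sub>1 \<and>
           dilation_defined c u\<^sub>1 u\<^sub>2 \<and> dilation c u\<^sub>1 u\<^sub>2 = 1) \<and>
         (\<forall>u\<^sub>1 u\<^sub>2 :: real ^ 'n. norm u\<^sub>1 < c \<longrightarrow> norm u\<^sub>2 < c \<longrightarrow>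
           dilation_defined c u\<^sub>1 u\<^sub>2 \<longrightarrow> dilation_defined c u\<^sub>2 u\<^sub>1 \<longrightarrow>
           dilation c u\<^sub>1 u\<^sub>2 / dilation c u\<^sub>2 u\<^sub>1 =
             sqrt ((D_fun c u\<^sub>1 u\<^sub>2 (norm u\<^sub>2) * (c\<^sup>2 - (norm u\<^sub>1)\<^sup>2)) /
                   (D_fun c u\<^sub>1 u\<^sub>2 (norm u\<^sub>1) * (c\<^sup>2 - (norm u\<^sub>2)\<^sup>2)))) \<and>
         (\<forall>\<^sub>F (u\<^sub>1, u\<^sub>2) in (slow c :: ((real ^ 'n) \<times> (real ^ 'n)) filter).
           dilation_defined c u\<^sub>1 u\<^sub>2 \<and> dilation_defined c u\<^sub>2 u\<^sub>1) \<and>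
         (\<lambda>z :: (real ^ 'n) \<times> (real ^ 'n). exchange_ratio c z - 1)
           \<in> O[slow c](\<lambda>z. max_speed_ratio c z ^ 4) \<and>
         (\<exists>P :: (real ^ 'n) \<times> (real ^ 'n) \<Rightarrow> real.
           homogeneous_polynomial 4 P \<and> (\<exists>z. P z \<noteq> 0) \<and>
           (\<lambda>z. exchange_ratio c z - 1 - P z) \<in> o[slow c](\<lambda>z. max_speed_ratio c z ^ 4))"
proof (intro conjI allI impI)
  fix u\<^sub>1 u\<^sub>2 :: "real ^ 'n"
  assume less: "norm u\<^sub>1 < c" "norm u\<^sub>2 < c"
  {
    assume orth: "u\<^sub>1 \<bullet> u\<^sub>2 = 0"
    show "two_step_velocity c u\<^sub>1 u\<^sub>2 = einstein_add c u\<^sub>2 u\<^sub>1"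
      by (rule orthogonal_two_step[OF less orth])
    show "dilation_defined c u\<^sub>1 u\<^sub>2" "dilation c u\<^sub>1 u\<^sub>2 = 1"
      by (simp_all add: dilation_defined_def dilation_def orthogonal_two_step[OF less orth])
  }
  show "dilation c u\<^sub>1 u\<^sub>2 / dilation c u\<^sub>2 u\<^sub>1 =
      sqrt ((D_fun c u\<^sub>1 u\<^sub>2 (norm u\<^sub>2) * (c\<^sup>2 - (norm u\<^sub>1)\<^sup>2)) /
            (D_fun c u\<^sub>1 u\<^sub>2 (norm u\<^sub>1) * (c\<^sup>2 - (norm u\<^sub>2)\<^sup>2)))"
    by (rule dilation_ratio[OF less])
next
  \<comment> \<open>Since \<open>dilation\<close> is meaningful only under
    \<open>dilation_defined\<close>, this ensures that the asymptotic claims concern genuine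
    dilations.\<close>
  show "\<forall>\<^sub>F (u\<^sub>1, u\<^sub>2) in (slow c :: ((real ^ 'n) \<times> (real ^ 'n)) filter).
      dilation_defined c u\<^sub>1 u\<^sub>2 \<and> dilation_defined c u\<^sub>2 u\<^sub>1"
  proof (rule eventually_slow[of _ "1 / 4"])
    fix z :: "(real ^ 'n) \<times> (real ^ 'n)"
    assume less: "max_speed_ratio c z < 1 / 4"
    obtain u\<^sub>1 u\<^sub>2 where z: "z = (u\<^sub>1, u\<^sub>2)"
      by (cases z)
    have "max_speed_ratio c (u\<^sub>2, u\<^sub>1) = max_speed_ratio c (u\<^sub>1, u\<^sub>2)"
      by (simp add: max_speed_ratio_def max.commute)
    then have "dilation_defined c u\<^sub>1 u\<^sub>2" "dilation_defined c u\<^sub>2 u\<^sub>1"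
      using less by (auto intro!: slow_dilation_defined[OF assms(1)] simp only: z)
    then show "case z of (u\<^sub>1, u\<^sub>2) \<Rightarrow> dilation_defined c u\<^sub>1 u\<^sub>2 \<and> dilation_defined c u\<^sub>2 u\<^sub>1"
      by (simp add: z)
  qed simp
next
  show "(\<lambda>z :: (real ^ 'n) \<times> (real ^ 'n). exchange_ratio c z - 1)
      \<in> O[slow c](\<lambda>z. max_speed_ratio c z ^ 4)"
    \<comment> \<open>The deviation from 1 is the remainder plus \<open>exchange_term c\<close>,
      each of order \<open>M ^ 4\<close>.\<close>
    using sum_in_bigo(1)[OF landau_o.small_imp_big[OF exchange_ratio_smallo[OF assms(1)]]
        exchange_term_bigo[OF assms(1)]] by simp
next
  show "\<exists>P :: (real ^ 'n) \<times> (real ^ 'n) \<Rightarrow> real.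
      homogeneous_polynomial 4 P \<and> (\<exists>z. P z \<noteq> 0) \<and>
      (\<lambda>z. exchange_ratio c z - 1 - P z) \<in> o[slow c](\<lambda>z. max_speed_ratio c z ^ 4)"
    using homogeneous_exchange_term exchange_term_nonzero[OF assms(1)] exchange_ratio_smallo[OF assms(1)]
    by blast
qed

end
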